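(* Let $\Gamma$ be a finite group of order $n$, $H\subseteq\Gamma$ nonempty with $|H|=h$, and let $G=\mathrm{Cay}(\Gamma,H)$ have girth $m$. Let the activation threshold be $t=h$. Then for $1\le s\le n$, $d_{st}(G)=n-s$ whenever $s>n-m$, and $d_{st}(G)=\infty$ otherwise.
   Context: The Cayley digraph $\mathrm{Cay}(\Gamma,H)$ has vertex set $\Gamma$ and an edge from $x$ to $y$ whenever $y=hx$ for some $h\in H$. The girth of a digraph is the minimum length of a directed cycle in it. Activation process: given a digraph with vertex set $V$, a set $S\subseteq V$ and threshold $t$, put $S_0=S$ and $S_i=S_{i-1}\cup\{v\notin S_{i-1}: v \text{ has at least } t \text{ edges } (u,v) \text{ with } u\in S_{i-1}\}$ for $i\ge1$. $d(S,t)$ is the smallest $i$ with $S_i=V$ ($\infty$ if none exists), and $d_{st}(G)=\max\{d(S,t): S\subseteq V,\ |S|=s\}$. *)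

theory Defs
  imports
    "HOL-Algebra.Coset"
    "HOL-Library.Extended_Nat"
    "Graph_Theory.Arc_Walk"
begin

(* Edges go from x to h x (left multiplication); loops occur exactly when the unit is in H. *)
definition cayley_digraph :: "('a, 'm) monoid_scheme \<Rightarrow> 'a set \<Rightarrow> ('a, 'a \<times> 'a) pre_digraph" where
  "cayley_digraph \<Gamma> H =
     \<lparr> verts = carrier \<Gamma>,
       arcs = {(x, y). x \<in> carrier \<Gamma> \<and> (\<exists>h\<in>H. y = h \<otimes>\<^bsub>\<Gamma>\<^esub> x)},
       tail = fst,
       head = snd \<rparr>"

(* Cycles are directed and may have length 1 (a loop) or 2 (a pair of opposite edges).
   The girth of an acyclic digraph is infinity. *)
definition girth :: "('a, 'b) pre_digraph \<Rightarrow> enat" where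
  "girth G = (INF p \<in> {p. pre_digraph.cycle G p}. enat (length p))"

primrec activated :: "('a, 'b) pre_digraph \<Rightarrow> nat \<Rightarrow> 'a set \<Rightarrow> nat \<Rightarrow> 'a set" where
  "activated G t S 0 = S"
| "activated G t S (Suc i) =
     activated G t S i \<union>
     {v \<in> verts G - activated G t S i.
        t \<le> card {e \<in> in_arcs G v. tail G e \<in> activated G t S i}}"

(* The infimum of the empty set is infinity in enat. *)
definition activation_time :: "('a, 'b) pre_digraph \<Rightarrow> nat \<Rightarrow> 'a set \<Rightarrow> enat" where
  "activation_time G t S = Inf {enat i | i. activated G t S i = verts G}"

(* Meaningful for a finite vertex set and s at most its cardinality,
   where the maximum is over a finite nonempty set. *)
definition max_activation_time :: "('a, 'b) pre_digraph \<Rightarrow> nat \<Rightarrow> nat \<Rightarrow> enat" where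
  "max_activation_time G s t =
     Max {activation_time G t S | S. S \<subseteq> verts G \<and> card S = s}"

end

(* With t equal to the in-degree, a vertex is activated once all its in-neighbours are active.
   A set of inactive vertices in which every vertex has an in-neighbour inside the set is
   therefore never activated, and such a set contains a cycle. Fewer than m inactive vertices
   cannot contain one, so each round activates at least one of them, and the inactive set
   consisting of the vertices of a walk loses exactly one per round. If at least m vertices
   are inactive, they can be chosen to include a shortest cycle.
   The group enters only through the fact that its Cayley digraph is regular. *)

theory Submission
  imports Defs
begin

section \<open>Girth, closed walks and walks inside a vertex set\<close>

context wf_digraph
begin

text \<open>A closed walk that is not a cycle contains a strictly shorter closed walk, so induction
  on the length descends to a cycle.\<close>

lemma girth_le_closed_w:
  assumes "closed_w p"
  shows "girth G \<le> enat (length p)"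
  using assms
proof (induction "length p" arbitrary: p rule: less_induct)
  case less
  then obtain u where u: "awalk u p u" "p \<noteq> []"
    by (auto simp: closed_w_def)
  then obtain e es where p: "p = e # es"
    by (cases p) auto
  show ?case
  proof (cases "distinct (tl (awalk_verts u p))")
    case True
    then have "cycle p"
      using u by (auto simp: cycle_def)
    then show ?thesis
      unfolding girth_def by (auto intro: INF_lower)
  next
    case False
    \<comment> \<open>The first arc is dropped before decomposing: \<open>p\<close> itself always
      repeats \<open>u\<close>, so its decomposition could return \<open>p\<close> again. A closed
      subwalk of \<open>es\<close> is strictly shorter.\<close>
    have "awalk (head G e) es u" "\<not> distinct (awalk_verts (head G e) es)"
      using u False by (auto simp: p awalk_Cons_iff)
    from awalk_not_distinct_decomp[OF this] obtain q r s
      where "es = q @ r @ s" "closed_w r"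
      by (auto simp: closed_w_def)
    then have "closed_w r" "length r < length p"
      by (auto simp: p)
    then have "girth G \<le> enat (length r)"
      using less.hyps by blast
    also have "\<dots> \<le> enat (length p)"
      using \<open>length r < length p\<close> by simp
    finally show ?thesis .
  qed
qed

lemma girth_le_awalk:
  assumes "awalk u p v" "\<not> distinct (awalk_verts u p)"
  shows "girth G \<le> enat (length p)"
proof -
  from awalk_not_distinct_decomp[OF assms] obtain q r s
    where "p = q @ r @ s" "closed_w r"
    by (auto simp: closed_w_def)
  then have "girth G \<le> enat (length r)" "enat (length r) \<le> enat (length p)"
    using girth_le_closed_w by auto
  then show ?thesis
    by (rule order_trans)
qed

text \<open>Every vertex of \<open>W\<close> has a predecessor in \<open>W\<close>, so a walk can be
  prolonged at its start without ever leaving \<open>W\<close>.\<close>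

lemma awalk_within:
  assumes "W \<subseteq> verts G" "W \<noteq> {}" "\<And>w. w \<in> W \<Longrightarrow> \<exists>e\<in>in_arcs G w. tail G e \<in> W"
  shows "\<exists>u p v. awalk u p v \<and> length p = l \<and> set (awalk_verts u p) \<subseteq> W"
proof (induction l)
  case 0
  from assms obtain w where "w \<in> W" "w \<in> verts G"
    by blast
  then have "awalk w [] w \<and> length ([] :: 'b list) = 0 \<and> set (awalk_verts w []) \<subseteq> W"
    by (simp add: awalk_Nil_iff)
  then show ?case
    by blast
next
  case (Suc l)
  then obtain u p v where p: "awalk u p v" "length p = l" "set (awalk_verts u p) \<subseteq> W"
    by blast
  then have "u \<in> W"
    using hd_in_awalk_verts(1) by blast
  then obtain e where "e \<in> in_arcs G u" "tail G e \<in> W"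
    using assms(3) by blast
  then have "awalk (tail G e) (e # p) v \<and> length (e # p) = Suc l
      \<and> set (awalk_verts (tail G e) (e # p)) \<subseteq> W"
    using p by (auto simp: awalk_Cons_iff)
  then show ?case
    by blast
qed

text \<open>By the pigeonhole principle: a walk with \<open>card W\<close> arcs inside
  \<open>W\<close> visits \<open>card W + 1\<close> vertices, hence repeats one.\<close>

lemma girth_le_card:
  assumes "finite W" "W \<subseteq> verts G" "W \<noteq> {}"
    and "\<And>w. w \<in> W \<Longrightarrow> \<exists>e\<in>in_arcs G w. tail G e \<in> W"
  shows "girth G \<le> enat (card W)"
proof -
  obtain u p v where p: "awalk u p v" "length p = card W" "set (awalk_verts u p) \<subseteq> W"
    using awalk_within[OF assms(2-4)] by blast
  have "card (set (awalk_verts u p)) \<le> card W"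
    using p(3) assms(1) by (rule card_mono[rotated])
  then have "\<not> distinct (awalk_verts u p)"
    using p(2) by (auto dest: distinct_card simp: length_awalk_verts)
  then show ?thesis
    using girth_le_awalk[OF p(1)] p(2) by simp
qed

text \<open>A finite girth is an infimum over a nonempty set of \<open>enat\<close>, hence attained
  by some cycle. On its vertex set each vertex has its predecessor along the cycle.\<close>

lemma shortest_cycle_verts:
  assumes "girth G = enat m"
  obtains W where "finite W" "W \<subseteq> verts G" "W \<noteq> {}" "card W = m"
    and "\<And>w. w \<in> W \<Longrightarrow> \<exists>e\<in>in_arcs G w. tail G e \<in> W"
proof -
  have "{p. cycle p} \<noteq> {}"
  proof
    assume "{p. cycle p} = {}"
    then have "girth G = \<infinity>"
      unfolding girth_def by (simp only: image_empty Inf_enat_def simp_thms if_True)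
    then show False
      using assms by simp
  qed
  then have "girth G \<in> (\<lambda>p. enat (length p)) ` {p. cycle p}"
    unfolding girth_def by (auto intro: wellorder_InfI)
  then obtain p where p: "cycle p" "length p = m"
    using assms by auto
  then obtain u where u: "awalk u p u" "distinct (tl (awalk_verts u p))" "p \<noteq> []"
    by (auto simp: cycle_def)
  then have cas: "cas u p u"
    by blast
  have tl: "tl (awalk_verts u p) = map (head G) p"
    using awalk_verts_conv'[OF cas] u(3) by simp
  \<comment> \<open>The vertex set is represented by the heads of the arcs. As the walk is closed,
    its start is also such a head, so all tails lie in this set.\<close>
  have "u = head G (last p)"
    using u awlast_if_cas[OF cas] by (simp add: awalk_verts_conv)
  then have "u \<in> head G ` set p"
    using u(3) by simp
  moreover have "set (awalk_verts u p) = insert u (head G ` set p)"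
    using awalk_verts_conv'[OF cas] cas cas_simp[OF u(3)] u(3) by auto
  ultimately have verts: "tail G ` set p \<subseteq> head G ` set p"
    by (metis awalk_verts_arc1 image_subsetI insert_absorb)
  show ?thesis
  proof
    show "head G ` set p \<subseteq> verts G"
      using u(1) by (auto simp: awalk_def intro!: head_in_verts)
    show "card (head G ` set p) = m"
      using u(2) p(2) distinct_card[of "map (head G) p"] by (simp add: tl)
    show "\<exists>e\<in>in_arcs G w. tail G e \<in> head G ` set p" if w: "w \<in> head G ` set p" for w
    proof -
      from w obtain e where "e \<in> set p" "head G e = w"
        by blast
      then show ?thesis
        using u(1) verts by (intro bexI[of _ e]) auto
    qed
  qed (use u(3) in auto)
qed

lemma awalk_nth:
  assumes "awalk u p v" "j < length p"
  shows "p ! j \<in> arcs G" "tail G (p ! j) = awalk_verts u p ! j"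
    "head G (p ! j) = awalk_verts u p ! Suc j"
proof -
  have cas: "cas u p v"
    using assms(1) by blast
  show "p ! j \<in> arcs G"
    using assms nth_mem by blast
  show "tail G (p ! j) = awalk_verts u p ! j"
    using assms(2) by (auto simp: awalk_verts_conv nth_append)
  show "head G (p ! j) = awalk_verts u p ! Suc j"
    using assms(2) awalk_verts_conv'[OF cas] by auto
qed

end

section \<open>Activation time in arbitrary digraphs\<close>

lemma activated_subset_verts:
  "S \<subseteq> verts G \<Longrightarrow> activated G t S i \<subseteq> verts G"
  by (induction i) auto

lemma activation_time_eq_infinity:
  "(\<And>i. activated G t S i \<noteq> verts G) \<Longrightarrow> activation_time G t S = \<infinity>"
  by (simp add: activation_time_def top_enat_def[symmetric])

lemma activation_time_le:
  "activated G t S i = verts G \<Longrightarrow> activation_time G t S \<le> enat i"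
  by (auto simp: activation_time_def intro: Inf_lower)

lemma activation_time_ge:
  "(\<And>i. activated G t S i = verts G \<Longrightarrow> k \<le> i) \<Longrightarrow> enat k \<le> activation_time G t S"
  by (auto simp: activation_time_def intro: Inf_greatest)

section \<open>Activation with threshold equal to the common in-degree\<close>

locale in_regular_digraph = fin_digraph +
  fixes t :: nat
  assumes in_degree: "v \<in> verts G \<Longrightarrow> in_degree G v = t"
begin

text \<open>There are exactly \<open>t\<close> arcs into \<open>v\<close>, so a set of at least
  \<open>t\<close> of them is the set of all of them.\<close>

lemma activated_Suc_iff:
  assumes "v \<in> verts G"
  shows "v \<in> activated G t S (Suc i) \<longleftrightarrow>
    v \<in> activated G t S i \<or> (\<forall>e\<in>in_arcs G v. tail G e \<in> activated G t S i)"
proof -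
  let ?E = "{e \<in> in_arcs G v. tail G e \<in> activated G t S i}"
  have t: "t = card (in_arcs G v)"
    using in_degree[OF assms] by (simp add: in_degree_def)
  have "t \<le> card ?E \<longleftrightarrow> ?E = in_arcs G v"
  proof
    assume "t \<le> card ?E"
    then show "?E = in_arcs G v"
      using t by (intro card_seteq) auto
  qed (simp only: t)
  then show ?thesis
    using assms by auto
qed

text \<open>Each vertex of \<open>W\<close> waits for another arc tail in \<open>W\<close> to be
  active, so no vertex of \<open>W\<close> can be activated first.\<close>

lemma activated_disjoint:
  assumes "W \<subseteq> verts G" "W \<inter> S = {}" "\<And>w. w \<in> W \<Longrightarrow> \<exists>e\<in>in_arcs G w. tail G e \<in> W"
  shows "W \<inter> activated G t S i = {}"
proof (induction i)
  case (Suc i)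
  have "w \<notin> activated G t S (Suc i)" if "w \<in> W" for w
  proof -
    have "w \<in> verts G" "w \<notin> activated G t S i"
      using that assms(1) Suc by auto
    moreover have "\<exists>e\<in>in_arcs G w. tail G e \<notin> activated G t S i"
      using assms(3)[OF that] Suc by blast
    ultimately show ?thesis
      using activated_Suc_iff by blast
  qed
  then show ?case
    by blast
qed (use assms in auto)

text \<open>As long as inactive vertices remain, they are too few to contain a cycle, so one of them
  has only active in-neighbours. The subtraction is truncated at 0, where all vertices are
  active.\<close>

lemma card_inactive_le:
  assumes "enat (card (verts G - S)) < girth G"
  shows "card (verts G - activated G t S i) \<le> card (verts G - S) - i"
proof (induction i)
  case (Suc i)
  let ?W = "verts G - activated G t S i" and ?W' = "verts G - activated G t S (Suc i)"
  show ?case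
  proof (cases "?W = {}")
    case True
    then have "?W' = {}"
      by auto
    then show ?thesis
      by (simp only: card.empty le0)
  next
    case False
    have "\<not> girth G \<le> enat (card ?W)"
      using assms Suc by (meson diff_le_self enat_ord_simps(1) leD order_trans)
    then obtain w where w: "w \<in> ?W" "\<forall>e\<in>in_arcs G w. tail G e \<notin> ?W"
      using girth_le_card[of ?W] False by auto
    then have "w \<in> activated G t S (Suc i)"
      using activated_Suc_iff[of w S i] by auto
    then have "?W' \<subset> ?W"
      using w(1) by auto
    then have "card ?W' < card ?W"
      by (intro psubset_card_mono) auto
    then show ?thesis
      using Suc by linarith
  qed
qed simp

text \<open>Activation advances by at most one vertex per round along an initially inactive walk:
  vertex \<open>j\<close> waits for vertex \<open>j - 1\<close>, and vertex 0 is not active before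
  round 1.\<close>

lemma activated_awalk:
  assumes "awalk u p v" "set (awalk_verts u p) \<inter> S = {}"
    and "j \<le> length p" "awalk_verts u p ! j \<in> activated G t S i"
  shows "j < i"
  using assms(3,4)
proof (induction i arbitrary: j)
  case 0
  then have "awalk_verts u p ! j \<in> set (awalk_verts u p)"
    by (simp add: length_awalk_verts)
  then show ?case
    using 0 assms(2) by auto
next
  case (Suc i)
  show ?case
  proof (cases j)
    case (Suc k)
    then have arc: "p ! k \<in> arcs G" "tail G (p ! k) = awalk_verts u p ! k"
      "head G (p ! k) = awalk_verts u p ! j"
      using awalk_nth[OF assms(1)] \<open>j \<le> length p\<close> by auto
    then have "awalk_verts u p ! j \<in> verts G"
      by (metis head_in_verts)
    then have "awalk_verts u p ! j \<in> activated G t S i \<or> awalk_verts u p ! k \<in> activated G t S i"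
      using Suc.prems(2) arc activated_Suc_iff[of "awalk_verts u p ! j"]
      by (metis in_in_arcs_conv)
    then show ?thesis
      using Suc.IH[of j] Suc.IH[of k] Suc.prems(1) Suc by auto
  qed simp
qed

lemma max_activation_time_eq:
  assumes "0 < t" "girth G = enat m" "s \<le> card (verts G)"
  shows "max_activation_time G s t = (if card (verts G) < s + m then enat (card (verts G) - s) else \<infinity>)"
proof -
  let ?T = "{activation_time G t S | S. S \<subseteq> verts G \<and> card S = s}"
  let ?k = "card (verts G) - s"
  have "finite (activation_time G t ` Pow (verts G))"
    by simp
  then have fin: "finite ?T"
    by (rule rev_finite_subset) auto
  show ?thesis
  proof (cases "card (verts G) < s + m")
    case True
    have le: "activation_time G t S \<le> enat ?k" if S: "S \<subseteq> verts G" "card S = s" for S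
    proof -
      have "card (verts G - S) = ?k"
        using S by (simp add: card_Diff_subset finite_subset)
      then have "card (verts G - activated G t S ?k) = 0"
        using card_inactive_le[of S ?k] True assms(2,3) by simp
      then have "activated G t S ?k = verts G"
        using activated_subset_verts[OF S(1)] by auto
      then show ?thesis
        by (rule activation_time_le)
    qed
    obtain S where S: "S \<subseteq> verts G" "card S = s" "enat ?k \<le> activation_time G t S"
    \<comment> \<open>The walk below has \<open>?k - 1\<close> arcs and thus \<open>?k\<close>
      vertices; for \<open>?k = 0\<close> truncated subtraction would still give one vertex.\<close>
    proof (cases "?k = 0")
      case True
      then show ?thesis
        using assms(3) by (intro that[of "verts G"]) (auto simp: zero_enat_def[symmetric])
    next
      case False
      \<comment> \<open>Since \<open>0 < t\<close>, every vertex has an in-neighbour, so walks of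
        any length exist in \<open>G\<close>.\<close>
      have "\<exists>e\<in>in_arcs G w. tail G e \<in> verts G" if "w \<in> verts G" for w
        using in_degree[OF that] assms(1)
        by (metis card.empty in_degree_def in_in_arcs_conv less_irrefl ex_in_conv tail_in_verts)
      moreover have "verts G \<noteq> {}"
        using False by auto
      ultimately obtain u p v where p: "awalk u p v" "length p = ?k - 1"
        using awalk_within[of "verts G" "?k - 1"] by blast
      have "\<not> girth G \<le> enat (length p)"
        using True False assms(2) p(2) by simp
      then have "distinct (awalk_verts u p)"
        using girth_le_awalk[OF p(1)] by blast
      then have card: "card (set (awalk_verts u p)) = ?k"
        using False p(2) by (simp add: distinct_card length_awalk_verts)
      have sub: "set (awalk_verts u p) \<subseteq> verts G"
        using p(1) by blast
      \<comment> \<open>The walk is shorter than the girth, so its \<open>?k\<close> vertices are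
        distinct and its complement has exactly \<open>s\<close> elements.\<close>
      let ?S = "verts G - set (awalk_verts u p)"
      show ?thesis
      proof (rule that[of ?S])
        show "card ?S = s"
          using card sub assms(3) by (simp add: card_Diff_subset)
        show "enat ?k \<le> activation_time G t ?S"
        proof (rule activation_time_ge)
          fix i
          assume "activated G t ?S i = verts G"
          \<comment> \<open>The last vertex of the walk has index \<open>?k - 1\<close>, so it is
            not active before round \<open>?k\<close>.\<close>
          then have "awalk_verts u p ! length p \<in> activated G t ?S i"
            using sub by (metis length_awalk_verts lessI nth_mem subsetD)
          then have "length p < i"
            using activated_awalk[OF p(1), of ?S "length p" i] by auto
          then show "?k \<le> i"
            using p(2) by simp
        qed
      qed auto
    qed
    then have "activation_time G t S = enat ?k"
      using le S(1,2) by (simp add: order_antisym)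
    then have "enat ?k \<in> ?T"
      using S(1,2) by (intro CollectI exI[of _ S] conjI) auto
    then have "Max ?T = enat ?k"
      using le by (intro Max_eqI[OF fin]) auto
    then show ?thesis
      using True by (simp add: max_activation_time_def)
  next
    case False
    obtain W where W: "finite W" "W \<subseteq> verts G" "W \<noteq> {}" "card W = m"
      and pred: "\<And>w. w \<in> W \<Longrightarrow> \<exists>e\<in>in_arcs G w. tail G e \<in> W"
      using shortest_cycle_verts[OF assms(2)] by blast
    \<comment> \<open>In this case \<open>s + m \<le> card (verts G)\<close>, which leaves room for
      \<open>s\<close> vertices off the shortest cycle.\<close>
    have "s \<le> card (verts G - W)"
      using W False by (simp add: card_Diff_subset)
    then obtain S where S: "S \<subseteq> verts G - W" "card S = s"
      using obtain_subset_with_card_n by metis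
    then have "W \<inter> activated G t S i = {}" for i
      using pred W(2) by (intro activated_disjoint) auto
    then have "activation_time G t S = \<infinity>"
      using W(2,3) by (intro activation_time_eq_infinity) blast
    then have "\<infinity> \<in> ?T"
      using S by (intro CollectI exI[of _ S] conjI) auto
    then have "Max ?T = \<infinity>"
      by (intro Max_eqI[OF fin]) auto
    then show ?thesis
      using False by (simp add: max_activation_time_def)
  qed
qed

end

section \<open>Cayley digraphs are in-regular\<close>

lemma in_arcs_cayley_digraph:
  assumes "group \<Gamma>" "H \<subseteq> carrier \<Gamma>" "v \<in> carrier \<Gamma>"
  shows "in_arcs (cayley_digraph \<Gamma> H) v = (\<lambda>h. (inv\<^bsub>\<Gamma>\<^esub> h \<otimes>\<^bsub>\<Gamma>\<^esub> v, v)) ` H"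
proof -
  interpret group \<Gamma> by fact
  have "x = inv\<^bsub>\<Gamma>\<^esub> h \<otimes>\<^bsub>\<Gamma>\<^esub> v \<longleftrightarrow> v = h \<otimes>\<^bsub>\<Gamma>\<^esub> x" if "h \<in> H" "x \<in> carrier \<Gamma>" for h x
    using that assms by (metis inv_solve_left subsetD)
  moreover have "inv\<^bsub>\<Gamma>\<^esub> h \<otimes>\<^bsub>\<Gamma>\<^esub> v \<in> carrier \<Gamma>" if "h \<in> H" for h
    using that assms by auto
  ultimately show ?thesis
    by (auto simp: cayley_digraph_def in_arcs_def image_iff)
qed

text \<open>Distinct elements of \<open>H\<close> yield distinct arcs into \<open>v\<close>, by
  right cancellation and injectivity of inversion.\<close>

lemma in_regular_cayley_digraph:
  assumes "group \<Gamma>" "finite (carrier \<Gamma>)" "H \<subseteq> carrier \<Gamma>"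
  shows "in_regular_digraph (cayley_digraph \<Gamma> H) (card H)"
proof -
  interpret group \<Gamma> by fact
  have sub: "arcs (cayley_digraph \<Gamma> H) \<subseteq> carrier \<Gamma> \<times> carrier \<Gamma>"
    using assms(3) by (auto simp: cayley_digraph_def)
  have "inj_on (\<lambda>h. (inv\<^bsub>\<Gamma>\<^esub> h \<otimes>\<^bsub>\<Gamma>\<^esub> v, v)) H" if "v \<in> carrier \<Gamma>" for v
    using that assms(3) by (intro inj_onI) (metis Pair_inject inv_closed inv_inv right_cancel subsetD)
  then have "in_degree (cayley_digraph \<Gamma> H) v = card H" if "v \<in> carrier \<Gamma>" for v
    using that by (simp add: in_degree_def in_arcs_cayley_digraph[OF assms(1,3)] card_image)
  moreover have "finite (arcs (cayley_digraph \<Gamma> H))"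
    using sub assms(2) by (auto intro: finite_subset)
  ultimately show ?thesis
    using assms(2,3) by unfold_locales (auto simp: cayley_digraph_def)
qed

theorem theorem2:
  fixes \<Gamma> :: "('a, 'm) monoid_scheme" and H :: "'a set" and n h m t s :: nat
  assumes "group \<Gamma>"
    and "finite (carrier \<Gamma>)"
    and "order \<Gamma> = n"
    and "H \<subseteq> carrier \<Gamma>"
    and "H \<noteq> {}"
    and "card H = h"
    and "girth (cayley_digraph \<Gamma> H) = enat m"
    and "t = h"
    and "1 \<le> s"
    and "s \<le> n"
  shows "max_activation_time (cayley_digraph \<Gamma> H) s t =
           (if int s > int n - int m then enat (n - s) else \<infinity>)"
proof -
  interpret in_regular_digraph "cayley_digraph \<Gamma> H" t
    using in_regular_cayley_digraph assms by blast
  have "card (verts (cayley_digraph \<Gamma> H)) = n"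
    using assms(3) by (simp add: cayley_digraph_def order_def)
  moreover have "0 < t"
    using assms by (metis card_gt_0_iff finite_subset)
  \<comment> \<open>The condition is moved from \<open>int\<close> to \<open>nat\<close> in a form
    free of truncated subtraction.\<close>
  moreover have "int s > int n - int m \<longleftrightarrow> n < s + m"
    by linarith
  ultimately show ?thesis
    using max_activation_time_eq[of m s] assms(7,10) by simp
qed

end
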